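(* Let $\Sigma_0=(A,B,C,D)$ be a system with $A\in\mathbb{R}^{n\times n}$, $B\in\mathbb{R}^{n\times m}$, $C\in\mathbb{R}^{p\times n}$, $D\in\mathbb{R}^{p\times m}$, let $d$ and $M\in\mathbb{R}^{p\times m(n+1)}$ be the coefficient vector and matrix associated with $\Sigma_0$ as in the context, and let $\{u_k\}_{k=0}^{N-1}$ be an input sequence with $u_k\in\mathbb{R}^m$. (i) If the signal $\{Mu_{[k-n,k]}\}_{k=n}^{N-1}$ is persistently exciting of order $1$, then, for any $x_0\in\mathbb{R}^n$, the output sequence $\{y_k(\Sigma_0,x_0,u)\}_{k=0}^{N-1}$ is persistently exciting of order $1$. (ii) If $\{Mu_{[k-n,k]}\}_{k=n}^{N-1}$ is $K_{\mathrm u}$-persistently exciting of order $1$ for some $K_{\mathrm u}\succ 0$, then, for any $x_0\in\mathbb{R}^n$, $\{y_k(\Sigma_0,x_0,u)\}_{k=0}^{N-1}$ is $K_{\mathrm y}$-persistently exciting of order $1$ with $$K_{\mathrm y}=\frac{1}{n+1}K_{\mathrm u}.$$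
   Context: All matrices are real; $\succ,\succeq$ denote the positive definite / semidefinite ordering of symmetric matrices. System: $\Sigma_0$ denotes the discrete-time linear time-invariant system $x_{k+1}=Ax_k+Bu_k$, $y_k=Cx_k+Du_k$ with $x_k\in\mathbb{R}^n$, $u_k\in\mathbb{R}^m$, $y_k\in\mathbb{R}^p$. $\{y_k(\Sigma_0,x_0,u)\}_{k=0}^{N-1}$ denotes the output sequence generated by applying $\{u_k\}_{k=0}^{N-1}$ to $\Sigma_0$ with initial condition $x_0$. Windows: $u_{[a,b]}=\begin{bmatrix}u_a^\top&\dots&u_b^\top\end{bmatrix}^\top$. Hankel matrix: for a sequence $\{w_k\}_{k=0}^{N-1}$ with $w_k\in\mathbb{R}^q$, $H_L(w)\in\mathbb{R}^{qL\times(N-L+1)}$ is the block Hankel matrix whose columns are $w_{[k,k+L-1]}$, $k=0,\dots,N-L$ (and analogously for sequences with other index ranges). Persistence of excitation: $\{w_k\}_{k=0}^{N-1}$ with $w_k\in\mathbb{R}^q$ is persistently exciting (PE) of order $L$ if $\mathrm{rank}(H_L(w))=qL$. It is $K$-persistently exciting ($K$-PE) of order $L$, for a symmetric matrix $K\succ0$, if $H_L(w)H_L(w)^\top=\sum_{k=0}^{N-L}w_{[k,k+L-1]}w_{[k,k+L-1]}^\top\succeq K$. In particular, for order $1$ and a signal indexed by $k=n,\dots,N-1$, the sum is $\sum_{k=n}^{N-1}w_kw_k^\top$. The vector $d$ and matrix $M$: fix a polynomial $d(z)=\sum_{j=0}^n d_jz^{n-j}$ with real coefficients, $d_0\neq0$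 and $d(A)=0$ (it exists by Cayley-Hamilton), and set $d=\begin{bmatrix}d_n&\cdots&d_1&d_0\end{bmatrix}^\top\in\mathbb{R}^{n+1}$, normalized so that $\lVert d\rVert_2=1$. The Markov parameters are $\Gamma_0=D$, $\Gamma_i=CA^{i-1}B$ for $i=1,\dots,n$. Then $M=\begin{bmatrix}M_n&\dots&M_1&M_0\end{bmatrix}\in\mathbb{R}^{p\times m(n+1)}$ with $M_j=\sum_{q=0}^{j}d_{j-q}\Gamma_q$. *)

theory Defs
  imports "Jordan_Normal_Form.DL_Rank"
begin

text \<open>Matrices and vectors carry their dimensions as natural numbers (\<^typ>\<open>real mat\<close>,
  \<^typ>\<open>real vec\<close>); a signal is a function on the naturals of which only the indices in the
  stated range matter.\<close>

subsection \<open>Linear time-invariant systems\<close>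

primrec lti_state ::
  "real mat \<Rightarrow> real mat \<Rightarrow> real vec \<Rightarrow> (nat \<Rightarrow> real vec) \<Rightarrow> nat \<Rightarrow> real vec" where
  "lti_state A B x0 u 0 = x0"
| "lti_state A B x0 u (Suc k) = A *\<^sub>v lti_state A B x0 u k + B *\<^sub>v u k"

definition lti_output ::
  "real mat \<Rightarrow> real mat \<Rightarrow> real mat \<Rightarrow> real mat \<Rightarrow> real vec \<Rightarrow> (nat \<Rightarrow> real vec) \<Rightarrow> nat \<Rightarrow> real vec" where
  "lti_output A B C D x0 u k = C *\<^sub>v lti_state A B x0 u k + D *\<^sub>v u k"

subsection \<open>Windows, Hankel matrices and persistence of excitation\<close>

text \<open>\<open>window q a b w\<close> is the stacked vector of \<open>w a, \<dots>, w b\<close> (both ends included), each of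
  dimension \<open>q\<close>.\<close>

definition window :: "nat \<Rightarrow> nat \<Rightarrow> nat \<Rightarrow> (nat \<Rightarrow> real vec) \<Rightarrow> real vec" where
  "window q a b w = vec (q * (b + 1 - a)) (\<lambda>i. w (a + i div q) $ (i mod q))"

text \<open>In the following, \<open>w\<close> is a \<open>q\<close>-dimensional signal indexed by \<open>k = a, \<dots>, b - 1\<close>. The
  columns of its Hankel matrix of depth \<open>L\<close> start at \<open>k = a, \<dots>, b - L\<close>; there are none if the
  signal is shorter than \<open>L\<close>.\<close>

definition hankel :: "nat \<Rightarrow> nat \<Rightarrow> nat \<Rightarrow> nat \<Rightarrow> (nat \<Rightarrow> real vec) \<Rightarrow> real mat" where
  "hankel q L a b w = mat_of_cols (q * L) (map (\<lambda>k. window q k (k + L - 1) w) [a..<b + 1 - L])"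

definition persistently_exciting :: "nat \<Rightarrow> nat \<Rightarrow> nat \<Rightarrow> nat \<Rightarrow> (nat \<Rightarrow> real vec) \<Rightarrow> bool" where
  "persistently_exciting q L a b w \<longleftrightarrow> vec_space.rank (q * L) (hankel q L a b w) = q * L"

definition pos_def :: "nat \<Rightarrow> real mat \<Rightarrow> bool" where
  "pos_def r X \<longleftrightarrow> X \<in> carrier_mat r r \<and> transpose_mat X = X \<and>
     (\<forall>v \<in> carrier_vec r. v \<noteq> 0\<^sub>v r \<longrightarrow> v \<bullet> (X *\<^sub>v v) > 0)"

definition pos_semidef :: "nat \<Rightarrow> real mat \<Rightarrow> bool" where
  "pos_semidef r X \<longleftrightarrow> X \<in> carrier_mat r r \<and> transpose_mat X = X \<and>
     (\<forall>v \<in> carrier_vec r. v \<bullet> (X *\<^sub>v v) \<ge> 0)"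

definition K_persistently_exciting ::
  "real mat \<Rightarrow> nat \<Rightarrow> nat \<Rightarrow> nat \<Rightarrow> nat \<Rightarrow> (nat \<Rightarrow> real vec) \<Rightarrow> bool" where
  "K_persistently_exciting K q L a b w \<longleftrightarrow> pos_def (q * L) K \<and>
     pos_semidef (q * L) (hankel q L a b w * transpose_mat (hankel q L a b w) - K)"

subsection \<open>The coefficient vector and the matrix associated with a system\<close>

definition sum_mats :: "nat \<Rightarrow> nat \<Rightarrow> (nat \<Rightarrow> real mat) \<Rightarrow> nat set \<Rightarrow> real mat" where
  "sum_mats nr nc F S = mat nr nc (\<lambda>ij. \<Sum>q\<in>S. F q $$ ij)"

text \<open>The value at \<open>A\<close> of the polynomial \<open>d(z) = \<Sum>j\<le>n. d j * z ^ (n - j)\<close>; the coefficients are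
  numbered from the highest power downwards.\<close>

definition poly_at_mat :: "nat \<Rightarrow> (nat \<Rightarrow> real) \<Rightarrow> real mat \<Rightarrow> real mat" where
  "poly_at_mat n d A = sum_mats n n (\<lambda>j. d j \<cdot>\<^sub>m (A ^\<^sub>m (n - j))) {0..n}"

definition coeff_vec :: "nat \<Rightarrow> (nat \<Rightarrow> real) \<Rightarrow> real vec" where
  "coeff_vec n d = vec (n + 1) (\<lambda>i. d (n - i))"

definition norm2 :: "real vec \<Rightarrow> real" where
  "norm2 v = sqrt (v \<bullet> v)"

fun markov :: "real mat \<Rightarrow> real mat \<Rightarrow> real mat \<Rightarrow> real mat \<Rightarrow> nat \<Rightarrow> real mat" where
  "markov A B C D 0 = D"
| "markov A B C D (Suc i) = C * (A ^\<^sub>m i) * B"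

definition M_block ::
  "nat \<Rightarrow> nat \<Rightarrow> (nat \<Rightarrow> real) \<Rightarrow> real mat \<Rightarrow> real mat \<Rightarrow> real mat \<Rightarrow> real mat \<Rightarrow> nat \<Rightarrow> real mat" where
  "M_block m p d A B C D j = sum_mats p m (\<lambda>q. d (j - q) \<cdot>\<^sub>m markov A B C D q) {0..j}"

text \<open>The block row \<open>[M\<^sub>n \<dots> M\<^sub>1 M\<^sub>0]\<close> with blocks of width \<open>m\<close>.\<close>

definition M_mat ::
  "nat \<Rightarrow> nat \<Rightarrow> nat \<Rightarrow> (nat \<Rightarrow> real) \<Rightarrow> real mat \<Rightarrow> real mat \<Rightarrow> real mat \<Rightarrow> real mat \<Rightarrow> real mat" where
  "M_mat n m p d A B C D =
     mat p (m * (n + 1)) (\<lambda>(i, c). M_block m p d A B C D (n - c div m) $$ (i, c mod m))"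

end

theory Submission
  imports Defs
begin

text \<open>Since the polynomial with coefficients \<open>d\<close> annihilates \<open>A\<close>, filtering the output with it removes
  the state: \<open>z k = M *\<^sub>v u\<^bsub>[k-n,k]\<^esub>\<close> equals \<open>\<Sum>j\<le>n. d j * y (k - j)\<close>. Hence every \<open>z k\<close> lies in
  the span of the outputs, and if the \<open>z k\<close> span the whole space, so do the outputs.
  Quantitatively, Cauchy-Schwarz and the normalization of \<open>d\<close> give
  \<open>(z k \<bullet> v)\<^sup>2 \<le> \<Sum>j\<le>n. (y (k - j) \<bullet> v)\<^sup>2\<close>; in the sum over \<open>k\<close> every output occurs at most
  \<open>n + 1\<close> times, which is the factor lost in \<open>K\<^sub>y\<close>.\<close>

section \<open>Spans of indexed families and the rank of a matrix\<close>

text \<open>\<open>lincomb\<close> sums over a set of vectors, whereas outputs form an indexed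
  family that may repeat values; induction over the index set avoids merging coefficients.\<close>

lemma (in vec_space) lincomb_family_in_span:
  assumes "finite J" and W: "W \<subseteq> carrier_vec n" and "f ` J \<subseteq> W"
  shows "vec n (\<lambda>i. \<Sum>j\<in>J. c j * f j $ i) \<in> span W"
  using assms(1,3)
proof (induction J rule: finite_induct)
  case empty
  have "vec n (\<lambda>i. \<Sum>j\<in>{}. c j * f j $ i) = 0\<^sub>v n"
    by auto
  then show ?case
    \<comment> \<open>The empty combination accepts any coefficient function, hence
      \<open>undefined\<close>.\<close>
    by (intro in_spanI[of _ undefined "{}"]) (simp_all add: lincomb_def)
next
  case (insert x F)
  have fx: "f x \<in> W" "f x \<in> carrier_vec n"
    using insert.prems W by auto
  have "c x \<cdot>\<^sub>v f x + vec n (\<lambda>i. \<Sum>j\<in>F. c j * f j $ i) \<in> span W"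
    using span_add1[OF W smult_in_span[OF W span_mem[OF W fx(1)]] insert.IH] insert.prems
    by simp
  moreover have "vec n (\<lambda>i. \<Sum>j\<in>insert x F. c j * f j $ i) =
      c x \<cdot>\<^sub>v f x + vec n (\<lambda>i. \<Sum>j\<in>F. c j * f j $ i)"
    using insert.hyps fx by (intro eq_vecI) auto
  ultimately show ?case
    by simp
qed

text \<open>\<open>rank\<close> is the dimension of the column span. If it is \<open>n\<close>, a
  maximal independent set of columns has \<open>n\<close> elements and so is a basis; conversely, a
  span that is the whole space has its dimension.\<close>

lemma (in vec_space) rank_eq_dim_iff_span:
  assumes A: "A \<in> carrier_mat n nc"
  shows "rank A = n \<longleftrightarrow> span (set (cols A)) = carrier_vec n"
proof
  have cols: "set (cols A) \<subseteq> carrier_vec n"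
    using A cols_dim by blast
  assume r: "rank A = n"
  obtain S where S: "finite S" "maximal S (\<lambda>T. T \<subseteq> set (cols A) \<and> lin_indpt T)"
    using maximal_exists_superset[of "set (cols A)" "\<lambda>T. T \<subseteq> set (cols A) \<and> lin_indpt T" "{}"]
    by (auto simp: finite_lin_indpt2)
  have sub: "S \<subseteq> set (cols A)" and li: "lin_indpt S"
    using S(2) by (auto simp: maximal_def)
  have "basis S"
    using rank_card_indpt[OF A S(2)] r sub cols li S(1)
    by (intro dim_li_is_basis) (use dim_is_n fin_dim in auto)
  then have "carrier_vec n \<subseteq> span (set (cols A))"
    using span_is_monotone[OF sub] by (auto simp: basis_def)
  then show "span (set (cols A)) = carrier_vec n"
    using span_closed[OF cols] by auto
next
  assume "span (set (cols A)) = carrier_vec n"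
  then have "rank A = vectorspace.dim class_ring V"
    unfolding rank_def by (simp add: module_vec_def)
  then show "rank A = n"
    using dim_is_n by simp
qed

section \<open>Excitation of order one as a spanning condition and as a quadratic form\<close>

lemma hankel_1_eq:
  assumes "w ` {a..<b} \<subseteq> carrier_vec q"
  shows "hankel q 1 a b w = mat_of_cols q (map w [a..<b])"
proof -
  have "window q k (k + 1 - 1) w = w k" if "a \<le> k" "k < b" for k
  proof -
    have "w k \<in> carrier_vec q"
      using assms that by auto
    then show ?thesis
      by (intro eq_vecI) (auto simp: window_def)
  qed
  then show ?thesis
    unfolding hankel_def by (auto intro!: arg_cong[of _ _ "mat_of_cols q"])
qed

lemma persistently_exciting_1_iff_span:
  assumes "w ` {a..<b} \<subseteq> carrier_vec q"
  shows "persistently_exciting q 1 a b w \<longleftrightarrow>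
    LinearCombinations.module.span class_ring (module_vec TYPE(real) q) (w ` {a..<b}) = carrier_vec q"
proof -
  interpret vec_space "TYPE(real)" q .
  have "set (cols (mat_of_cols q (map w [a..<b]))) = w ` {a..<b}"
    using assms by (subst cols_mat_of_cols) auto
  then show ?thesis
    using rank_eq_dim_iff_span[OF mat_of_cols_carrier(1)[of q "map w [a..<b]"]]
    by (simp add: persistently_exciting_def hankel_1_eq[OF assms] del: One_nat_def)
qed

text \<open>The form is the squared length of the transposed Hankel matrix applied to
  \<open>v\<close>, and the entries of that vector are the products
  \<open>w k \<bullet> v\<close>.\<close>

lemma hankel_1_quadratic_form:
  fixes w :: "nat \<Rightarrow> real vec"
  assumes w: "w ` {a..<b} \<subseteq> carrier_vec q"
    and v: "v \<in> carrier_vec q"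
  shows "v \<bullet> ((hankel q 1 a b w * transpose_mat (hankel q 1 a b w)) *\<^sub>v v) = (\<Sum>k=a..<b. (w k \<bullet> v)\<^sup>2)"
proof -
  define H where "H = hankel q 1 a b w"
  have H_eq: "H = mat_of_cols q (map w [a..<b])"
    unfolding H_def by (rule hankel_1_eq[OF w])
  have H: "H \<in> carrier_mat q (b - a)"
    unfolding H_eq using mat_of_cols_carrier(1)[of q "map w [a..<b]"] by simp
  have col: "col H i = w (a + i)" if "i < b - a" for i
    using that w unfolding H_eq by (subst col_mat_of_cols) auto
  have Hv: "transpose_mat H *\<^sub>v v \<in> carrier_vec (b - a)"
    using H v by simp
  have "v \<bullet> ((H * transpose_mat H) *\<^sub>v v) = v \<bullet> (H *\<^sub>v (transpose_mat H *\<^sub>v v))"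
    using H v by simp
  also have "\<dots> = (transpose_mat H *\<^sub>v v) \<bullet> (transpose_mat H *\<^sub>v v)"
    using transpose_vec_mult_scalar[OF H Hv v] H v Hv
    by simp
  also have "\<dots> = (\<Sum>i=0..<b - a. (w (a + i) \<bullet> v)\<^sup>2)"
    using H by (simp add: scalar_prod_def[of "transpose_mat H *\<^sub>v v"] col power2_eq_square)
  also have "\<dots> = (\<Sum>k=a..<b. (w k \<bullet> v)\<^sup>2)"
    by (rule sum.reindex_bij_witness[of _ "\<lambda>k. k - a" "\<lambda>i. a + i"]) auto
  finally show ?thesis
    unfolding H_def .
qed

section \<open>Trajectories and Markov parameters\<close>

lemma lti_state_carrier:
  assumes "A \<in> carrier_mat n n" "B \<in> carrier_mat n m" "x0 \<in> carrier_vec n"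
  shows "lti_state A B x0 u k \<in> carrier_vec n"
proof (cases k)
  case (Suc i)
  have "A *\<^sub>v lti_state A B x0 u i \<in> carrier_vec n" "B *\<^sub>v u i \<in> carrier_vec n"
    using assms(1,2) by (simp_all add: carrier_vecI)
  then show ?thesis
    using Suc by simp
qed (use assms in simp)

lemma lti_output_carrier:
  assumes "C \<in> carrier_mat p n" "D \<in> carrier_mat p m"
  shows "lti_output A B C D x0 u k \<in> carrier_vec p"
proof -
  have "C *\<^sub>v lti_state A B x0 u k \<in> carrier_vec p" "D *\<^sub>v u k \<in> carrier_vec p"
    using assms by (simp_all add: carrier_vecI)
  then show ?thesis
    by (simp add: lti_output_def)
qed

text \<open>Variation of constants started at time \<open>s\<close>: free response plus the
  convolution of inputs with Markov parameters. With \<open>s = k - n\<close>, all outputs of one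
  window are expressed through a single state.\<close>

lemma lti_output_index:
  assumes A: "A \<in> carrier_mat n n" and B: "B \<in> carrier_mat n m"
    and C: "C \<in> carrier_mat p n" and D: "D \<in> carrier_mat p m" and x0: "x0 \<in> carrier_vec n"
    and a: "a < p"
    and u: "\<And>k. k \<le> s + i \<Longrightarrow> u k \<in> carrier_vec m"
  shows "lti_output A B C D x0 u (s + i) $ a =
    (C *\<^sub>v (A ^\<^sub>m i *\<^sub>v lti_state A B x0 u s)) $ a +
    (\<Sum>q\<le>i. (markov A B C D q *\<^sub>v u (s + i - q)) $ a)"
  using u
\<comment> \<open>The start time varies: the output \<open>Suc i\<close> steps after
  \<open>s\<close> lies \<open>i\<close> steps after \<open>Suc s\<close>, so passing to the later
  start exposes just the term \<open>q = Suc i\<close>, the one with input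
  \<open>u s\<close>.\<close>
proof (induction i arbitrary: s)
  case 0
  then show ?case
    using A C D a lti_state_carrier[OF A B x0, of u s] by (simp add: lti_output_def)
next
  case (Suc i)
  define x where "x = lti_state A B x0 u s"
  have x: "x \<in> carrier_vec n"
    unfolding x_def by (rule lti_state_carrier[OF A B x0])
  have us: "u s \<in> carrier_vec m"
    using Suc.prems by simp
  have Ai: "A ^\<^sub>m i \<in> carrier_mat n n"
    using A by simp
  have "C *\<^sub>v (A ^\<^sub>m i *\<^sub>v lti_state A B x0 u (Suc s)) =
      C *\<^sub>v (A ^\<^sub>m Suc i *\<^sub>v x) + markov A B C D (Suc i) *\<^sub>v u s"
  proof -
    have "A ^\<^sub>m i *\<^sub>v (A *\<^sub>v x + B *\<^sub>v u s) = A ^\<^sub>m Suc i *\<^sub>v x + A ^\<^sub>m i *\<^sub>v (B *\<^sub>v u s)"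
      using A B Ai x us
      by (simp add: mult_add_distrib_mat_vec[OF Ai] assoc_mult_mat_vec[OF Ai A x])
    moreover have "C *\<^sub>v (A ^\<^sub>m Suc i *\<^sub>v x + A ^\<^sub>m i *\<^sub>v (B *\<^sub>v u s)) =
        C *\<^sub>v (A ^\<^sub>m Suc i *\<^sub>v x) + C *\<^sub>v (A ^\<^sub>m i *\<^sub>v (B *\<^sub>v u s))"
      using A Ai by (intro mult_add_distrib_mat_vec[OF C]) (auto simp: carrier_vecI)
    moreover have "C * A ^\<^sub>m i * B *\<^sub>v u s = C *\<^sub>v (A ^\<^sub>m i *\<^sub>v (B *\<^sub>v u s))"
      using A B C Ai us by (simp add: assoc_mult_mat_vec[of _ p n _ m] assoc_mult_mat_vec[of _ p n _ n])
    ultimately show ?thesis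
      by (simp add: x_def)
  qed
  moreover have "markov A B C D (Suc i) *\<^sub>v u s \<in> carrier_vec p"
    using C by (simp add: carrier_vecI)
  ultimately show ?case
    using Suc.IH[of "Suc s"] Suc.prems a C by (simp add: x_def)
qed

lemma markov_carrier:
  assumes "A \<in> carrier_mat n n" "B \<in> carrier_mat n m" "C \<in> carrier_mat p n" "D \<in> carrier_mat p m"
  shows "markov A B C D i \<in> carrier_mat p m"
  using assms by (cases i) auto

section \<open>The annihilating polynomial and the matrix \<open>M\<close>\<close>

text \<open>Collects the free responses in the filtered output into one term, which vanishes once
  the polynomial annihilates \<open>A\<close>. Since \<open>sum_mats\<close> is entrywise, the
  argument expands into entries and exchanges finite sums.\<close>

lemma poly_at_mat_observed_index:
  assumes A: "A \<in> carrier_mat n n" and C: "C \<in> carrier_mat p n" and x: "x \<in> carrier_vec n"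
    and a: "a < p"
  shows "(\<Sum>j\<le>n. d j * (C *\<^sub>v (A ^\<^sub>m (n - j) *\<^sub>v x)) $ a) = (C *\<^sub>v (poly_at_mat n d A *\<^sub>v x)) $ a"
proof -
  have Aj: "A ^\<^sub>m j \<in> carrier_mat n n" for j
    using A by simp
  have P: "poly_at_mat n d A \<in> carrier_mat n n"
    by (simp add: poly_at_mat_def sum_mats_def)
  have ix: "(C *\<^sub>v (X *\<^sub>v x)) $ a = (\<Sum>b<n. \<Sum>e<n. C $$ (a, b) * (X $$ (b, e) * x $ e))"
    if "X \<in> carrier_mat n n" for X
    using that C x a by (simp add: scalar_prod_def sum_distrib_left atLeast0LessThan)
  have "(\<Sum>j\<le>n. d j * (C *\<^sub>v (A ^\<^sub>m (n - j) *\<^sub>v x)) $ a) =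
      (\<Sum>j\<le>n. \<Sum>b<n. \<Sum>e<n. C $$ (a, b) * (d j * (A ^\<^sub>m (n - j)) $$ (b, e) * x $ e))"
    unfolding ix[OF Aj] by (simp add: sum_distrib_left mult_ac)
  also have "\<dots> = (\<Sum>b<n. \<Sum>e<n. \<Sum>j\<le>n. C $$ (a, b) * (d j * (A ^\<^sub>m (n - j)) $$ (b, e) * x $ e))"
    by (subst sum.swap) (intro sum.cong refl sum.swap)
  also have "\<dots> = (\<Sum>b<n. \<Sum>e<n. C $$ (a, b) * (poly_at_mat n d A $$ (b, e) * x $ e))"
    using Aj A by (intro sum.cong refl)
      (simp add: poly_at_mat_def sum_mats_def sum_distrib_left sum_distrib_right atLeast0AtMost)
  finally show ?thesis
    unfolding ix[OF P] .
qed

lemma M_mat_window_index: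
  assumes A: "A \<in> carrier_mat n n" and B: "B \<in> carrier_mat n m"
    and C: "C \<in> carrier_mat p n" and D: "D \<in> carrier_mat p m"
    and a: "a < p" and k: "n \<le> k" and u: "\<And>l. l \<le> n \<Longrightarrow> u (k - l) \<in> carrier_vec m"
  shows "(M_mat n m p d A B C D *\<^sub>v window m (k - n) k u) $ a =
    (\<Sum>l\<le>n. \<Sum>q\<le>l. d (l - q) * (markov A B C D q *\<^sub>v u (k - l)) $ a)"
proof -
  \<comment> \<open>Column \<open>c\<close> of \<open>M\<close> is column \<open>b = c mod m\<close>
    of the block at position \<open>t = c div m\<close>; \<open>f t b\<close> is its contribution to
    the product.\<close>
  define f where "f t b = M_block m p d A B C D (n - t) $$ (a, b) * u (k - n + t) $ b" for t b
  note mk = markov_carrier[OF A B C D]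
  have len: "k + 1 - (k - n) = n + 1"
    using k by simp
  have "(M_mat n m p d A B C D *\<^sub>v window m (k - n) k u) $ a = (\<Sum>c<(n + 1) * m. f (c div m) (c mod m))"
    using a unfolding window_def len
    by (auto simp: M_mat_def scalar_prod_def f_def atLeast0LessThan mult.commute intro!: sum.cong)
  also have "\<dots> = (\<Sum>t<n + 1. \<Sum>c=t * m..<t * m + m. f (c div m) (c mod m))"
    by (rule sum.nat_group[symmetric])
  also have "\<dots> = (\<Sum>t<n + 1. \<Sum>b<m. f t b)"
  proof (rule sum.cong[OF refl])
    fix t
    have "(\<Sum>c=t * m..<t * m + m. f (c div m) (c mod m)) =
        (\<Sum>b<m. f ((t * m + b) div m) ((t * m + b) mod m))"
      by (rule sum.reindex_bij_witness[of _ "\<lambda>b. t * m + b" "\<lambda>c. c - t * m"]) auto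
    also have "\<dots> = (\<Sum>b<m. f t b)"
      by (intro sum.cong refl) simp
    finally show "(\<Sum>c=t * m..<t * m + m. f (c div m) (c mod m)) = (\<Sum>b<m. f t b)" .
  qed
  \<comment> \<open>Blocks are stored with the highest index first, so reversing the order pairs
    block \<open>l\<close> with the delayed input \<open>u (k - l)\<close>.\<close>
  also have "\<dots> = (\<Sum>l\<le>n. \<Sum>b<m. f (n - l) b)"
    by (rule sum.reindex_bij_witness[of _ "\<lambda>l. n - l" "\<lambda>t. n - t"]) auto
  also have "\<dots> = (\<Sum>l\<le>n. \<Sum>q\<le>l. d (l - q) * (markov A B C D q *\<^sub>v u (k - l)) $ a)"
  proof (rule sum.cong[OF refl])
    fix l assume "l \<in> {..n}"
    then have l: "l \<le> n" "n - (n - l) = l" "k - n + (n - l) = k - l"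
      using k by auto
    have "(\<Sum>b<m. f (n - l) b) = (\<Sum>b<m. \<Sum>q\<le>l. d (l - q) * (markov A B C D q $$ (a, b) * u (k - l) $ b))"
      unfolding f_def l
      using a mk by (intro sum.cong refl)
        (simp add: M_block_def sum_mats_def sum_distrib_right atLeast0AtMost carrier_matD[OF mk] mult.assoc)
    also have "\<dots> = (\<Sum>q\<le>l. \<Sum>b<m. d (l - q) * (markov A B C D q $$ (a, b) * u (k - l) $ b))"
      by (rule sum.swap)
    also have "\<dots> = (\<Sum>q\<le>l. d (l - q) * (markov A B C D q *\<^sub>v u (k - l)) $ a)"
      using a u[OF l(1)] carrier_matD[OF mk]
      by (intro sum.cong refl) (simp add: scalar_prod_def sum_distrib_left atLeast0LessThan)
    finally show "(\<Sum>b<m. f (n - l) b) = (\<Sum>q\<le>l. d (l - q) * (markov A B C D q *\<^sub>v u (k - l)) $ a)" .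
  qed
  finally show ?thesis .
qed

text \<open>The annihilating polynomial cancels the contribution of the state \<open>x\<^bsub>k-n\<^esub>\<close>, so the filtered
  output depends on the input window only.\<close>

lemma M_mat_window_eq_filtered_output:
  assumes A: "A \<in> carrier_mat n n" and B: "B \<in> carrier_mat n m"
    and C: "C \<in> carrier_mat p n" and D: "D \<in> carrier_mat p m" and x0: "x0 \<in> carrier_vec n"
    and annihilates: "poly_at_mat n d A = 0\<^sub>m n n"
    and k: "n \<le> k" and u: "\<And>i. i \<le> k \<Longrightarrow> u i \<in> carrier_vec m"
  shows "M_mat n m p d A B C D *\<^sub>v window m (k - n) k u =
    vec p (\<lambda>a. \<Sum>j\<le>n. d j * lti_output A B C D x0 u (k - j) $ a)"
proof (rule eq_vecI)
  fix a assume "a < dim_vec (vec p (\<lambda>a. \<Sum>j\<le>n. d j * lti_output A B C D x0 u (k - j) $ a))"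
  then have a: "a < p"
    by simp
  define x where "x = lti_state A B x0 u (k - n)"
  define g where "g q i = (markov A B C D q *\<^sub>v u i) $ a" for q i
  have x: "x \<in> carrier_vec n"
    unfolding x_def by (rule lti_state_carrier[OF A B x0])
  \<comment> \<open>Each output \<open>k - j\<close> lies \<open>n - j\<close> steps after time
    \<open>k - n\<close>, so all free responses start from the same \<open>x\<close>.\<close>
  have "(\<Sum>j\<le>n. d j * lti_output A B C D x0 u (k - j) $ a) =
      (\<Sum>j\<le>n. d j * (C *\<^sub>v (A ^\<^sub>m (n - j) *\<^sub>v x)) $ a + (\<Sum>q\<le>n - j. d j * g q (k - (q + j))))"
  proof (intro sum.cong refl)
    fix j assume "j \<in> {..n}"
    then have j: "k - n + (n - j) = k - j"
      using k by auto
    show "d j * lti_output A B C D x0 u (k - j) $ a =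
        d j * (C *\<^sub>v (A ^\<^sub>m (n - j) *\<^sub>v x)) $ a + (\<Sum>q\<le>n - j. d j * g q (k - (q + j)))"
      using lti_output_index[OF A B C D x0 a, of "k - n" "n - j" u] u
      unfolding j by (simp add: x_def g_def sum_distrib_left distrib_left add.commute)
  qed
  also have "\<dots> = (C *\<^sub>v (poly_at_mat n d A *\<^sub>v x)) $ a + (\<Sum>j\<le>n. \<Sum>q\<le>n - j. d j * g q (k - (q + j)))"
    by (simp add: sum.distrib poly_at_mat_observed_index[OF A C x a])
  also have "(C *\<^sub>v (poly_at_mat n d A *\<^sub>v x)) $ a = 0"
    using C x a unfolding annihilates by (simp add: scalar_prod_def)
  \<comment> \<open>The triangle of pairs is regrouped along the total delay
    \<open>l = q + j\<close>, which turns \<open>d j\<close> into the coefficient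
    \<open>d (l - q)\<close> of block \<open>l\<close>.\<close>
  also have "(\<Sum>j\<le>n. \<Sum>q\<le>n - j. d j * g q (k - (q + j))) =
      (\<Sum>(q, j)\<in>{(q, j). q + j \<le> n}. d j * g q (k - (q + j)))"
    by (subst sum.Sigma) (auto intro!: sum.reindex_bij_witness[of _ prod.swap prod.swap])
  also have "\<dots> = (\<Sum>l\<le>n. \<Sum>q\<le>l. d (l - q) * g q (k - l))"
    by (subst sum.triangle_reindex_eq) simp
  also have "0 + \<dots> = (M_mat n m p d A B C D *\<^sub>v window m (k - n) k u) $ a"
    using M_mat_window_index[OF A B C D a k, of u d] u by (simp add: g_def)
  finally show "(M_mat n m p d A B C D *\<^sub>v window m (k - n) k u) $ a =
      vec p (\<lambda>a. \<Sum>j\<le>n. d j * lti_output A B C D x0 u (k - j) $ a) $ a"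
    using a by simp
qed (simp add: M_mat_def)

section \<open>Cauchy-Schwarz and the counting of overlapping windows\<close>

lemma square_sum_le_sum_squares:
  fixes c f :: "nat \<Rightarrow> real"
  assumes "(\<Sum>j\<in>J. (c j)\<^sup>2) = 1"
  shows "(\<Sum>j\<in>J. c j * f j)\<^sup>2 \<le> (\<Sum>j\<in>J. (f j)\<^sup>2)"
proof -
  \<comment> \<open>As \<open>c\<close> has unit length, \<open>s\<close> is the coefficient of the
    orthogonal projection of \<open>f\<close> onto \<open>c\<close>; the squared residual is the
    claimed difference.\<close>
  define s where "s = (\<Sum>j\<in>J. c j * f j)"
  have "0 \<le> (\<Sum>j\<in>J. (f j - s * c j)\<^sup>2)"
    by (simp add: sum_nonneg)
  also have "\<dots> = (\<Sum>j\<in>J. (f j)\<^sup>2 + s\<^sup>2 * (c j)\<^sup>2 - 2 * s * (c j * f j))"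
    by (simp add: power2_eq_square algebra_simps)
  also have "\<dots> = (\<Sum>j\<in>J. (f j)\<^sup>2) + s\<^sup>2 * (\<Sum>j\<in>J. (c j)\<^sup>2) - 2 * s * s"
    by (simp add: sum.distrib sum_subtractf sum_distrib_left s_def)
  finally show ?thesis
    using assms by (simp add: s_def power2_eq_square)
qed

text \<open>After exchanging the sums, each of the \<open>n + 1\<close> delays \<open>j\<close>
  yields a sum over \<open>{n - j..<N - j}\<close>, part of the full range; nonnegativity allows the
  missing terms to be added.\<close>

lemma sum_windows_le:
  fixes f :: "nat \<Rightarrow> real"
  assumes "\<And>k. 0 \<le> f k"
  shows "(\<Sum>k=n..<N. \<Sum>j\<le>n. f (k - j)) \<le> (real n + 1) * (\<Sum>k=0..<N. f k)"
proof -
  have "(\<Sum>k=n..<N. f (k - j)) \<le> (\<Sum>k=0..<N. f k)" if "j \<le> n" for j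
  proof -
    have "(\<Sum>k=n..<N. f (k - j)) = (\<Sum>k=n - j..<N - j. f k)"
      using that by (intro sum.reindex_bij_witness[of _ "\<lambda>k. k + j" "\<lambda>k. k - j"]) auto
    also have "\<dots> \<le> (\<Sum>k=0..<N. f k)"
      using assms by (intro sum_mono2) auto
    finally show ?thesis .
  qed
  then have "(\<Sum>j\<le>n. \<Sum>k=n..<N. f (k - j)) \<le> (\<Sum>j\<le>n. \<Sum>k=0..<N. f k)"
    by (intro sum_mono) simp
  then show ?thesis
    by (subst sum.swap) (simp add: add.commute)
qed

section \<open>Matrix inequalities through quadratic forms\<close>

lemma quadratic_form_smult:
  fixes X :: "real mat"
  assumes "X \<in> carrier_mat r r" "v \<in> carrier_vec r"
  shows "v \<bullet> ((c \<cdot>\<^sub>m X) *\<^sub>v v) = c * (v \<bullet> (X *\<^sub>v v))"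
  using assms by (auto simp: scalar_prod_def sum_distrib_left mult_ac intro!: sum.cong)

lemma pos_def_smult:
  assumes "pos_def r X" "0 < c"
  shows "pos_def r (c \<cdot>\<^sub>m X)"
proof -
  have "transpose_mat (c \<cdot>\<^sub>m X) = c \<cdot>\<^sub>m transpose_mat X"
    by (auto intro: eq_matI)
  then show ?thesis
    using assms by (auto simp: pos_def_def quadratic_form_smult[of X r])
qed

text \<open>Both the Gram matrix of the signal and \<open>K\<close> are symmetric, so the matrix
  inequality amounts to a scalar inequality for every \<open>v\<close>.\<close>

lemma K_persistently_exciting_1_iff:
  assumes w: "w ` {a..<b} \<subseteq> carrier_vec q"
  shows "K_persistently_exciting K q 1 a b w \<longleftrightarrow>
    pos_def q K \<and> (\<forall>v \<in> carrier_vec q. v \<bullet> (K *\<^sub>v v) \<le> (\<Sum>k=a..<b. (w k \<bullet> v)\<^sup>2))"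
proof (cases "pos_def q K")
  case True
  define H where "H = hankel q 1 a b w"
  have H: "H \<in> carrier_mat q (b - a)"
    unfolding H_def hankel_1_eq[OF w] using mat_of_cols_carrier(1)[of q "map w [a..<b]"] by simp
  have K: "K \<in> carrier_mat q q" "transpose_mat K = K"
    using True by (auto simp: pos_def_def)
  have G: "H * transpose_mat H \<in> carrier_mat q q"
    using H by simp
  have "transpose_mat (H * transpose_mat H) = H * transpose_mat H"
    using transpose_mult[OF H, of "transpose_mat H" q] H by simp
  then have sym: "transpose_mat (H * transpose_mat H - K) = H * transpose_mat H - K"
    using transpose_minus[OF G K(1)] K(2) by simp
  have "v \<bullet> ((H * transpose_mat H - K) *\<^sub>v v) = (\<Sum>k=a..<b. (w k \<bullet> v)\<^sup>2) - v \<bullet> (K *\<^sub>v v)"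
    if v: "v \<in> carrier_vec q" for v
  proof -
    have "v \<bullet> ((H * transpose_mat H - K) *\<^sub>v v) =
        v \<bullet> ((H * transpose_mat H) *\<^sub>v v) - v \<bullet> (K *\<^sub>v v)"
      unfolding minus_mult_distrib_mat_vec[OF G K(1) v]
      using G K(1) v by (intro scalar_prod_minus_distrib[of _ q]) auto
    then show ?thesis
      using hankel_1_quadratic_form[OF w v] by (simp add: H_def)
  qed
  then show ?thesis
    using True sym G K(1)
    unfolding K_persistently_exciting_def pos_semidef_def H_def[symmetric] by auto
qed (simp add: K_persistently_exciting_def)

theorem mainTheorem1:
  fixes n m p N :: nat
    and A B C D :: "real mat"
    and d :: "nat \<Rightarrow> real"
    and M :: "real mat"
    and u :: "nat \<Rightarrow> real vec"
  assumes A: "A \<in> carrier_mat n n"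
    and B: "B \<in> carrier_mat n m"
    and C: "C \<in> carrier_mat p n"
    and D: "D \<in> carrier_mat p m"
    and d0: "d 0 \<noteq> 0"
    and annihilates: "poly_at_mat n d A = 0\<^sub>m n n"
    and normalized: "norm2 (coeff_vec n d) = 1"
    and M: "M = M_mat n m p d A B C D"
    and u: "\<forall>k<N. u k \<in> carrier_vec m"
  shows
    "(persistently_exciting p 1 n N (\<lambda>k. M *\<^sub>v window m (k - n) k u) \<longrightarrow>
        (\<forall>x0 \<in> carrier_vec n. persistently_exciting p 1 0 N (lti_output A B C D x0 u))) \<and>
     (\<forall>Ku. pos_def p Ku \<and>
        K_persistently_exciting Ku p 1 n N (\<lambda>k. M *\<^sub>v window m (k - n) k u) \<longrightarrow>
        (\<forall>x0 \<in> carrier_vec n.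
           K_persistently_exciting ((1 / (real n + 1)) \<cdot>\<^sub>m Ku) p 1 0 N (lti_output A B C D x0 u)))"
proof (intro conjI impI ballI allI)
  let ?z = "\<lambda>k. M *\<^sub>v window m (k - n) k u"
  have z: "?z k \<in> carrier_vec p" for k
    unfolding M by (rule carrier_vecI) (simp add: M_mat_def)
  fix x0 :: "real vec"
  assume x0: "x0 \<in> carrier_vec n"
  define y where "y = lti_output A B C D x0 u"
  have y: "y k \<in> carrier_vec p" for k
    unfolding y_def by (rule lti_output_carrier[OF C D])
  \<comment> \<open>The bound \<open>k < N\<close> ensures that every input up to time
    \<open>k\<close> has dimension \<open>m\<close>.\<close>
  have z_eq: "?z k = vec p (\<lambda>a. \<Sum>j\<le>n. d j * y (k - j) $ a)" if "n \<le> k" "k < N" for k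
    unfolding M y_def
    using that u by (intro M_mat_window_eq_filtered_output[OF A B C D x0 annihilates]) auto
  have Z: "?z ` {n..<N} \<subseteq> carrier_vec p" and Y: "y ` {0..<N} \<subseteq> carrier_vec p"
    using z y by auto
  {
    assume "persistently_exciting p 1 n N ?z"
    interpret vec_space "TYPE(real)" p .
    have "?z ` {n..<N} \<subseteq> span (y ` {0..<N})"
    proof clarify
      fix k assume k: "k \<in> {n..<N}"
      have "(\<lambda>j. y (k - j)) ` {..n} \<subseteq> y ` {0..<N}"
        using k by auto
      then have "vec p (\<lambda>a. \<Sum>j\<le>n. d j * y (k - j) $ a) \<in> span (y ` {0..<N})"
        by (rule lincomb_family_in_span[OF finite_atMost Y])
      then show "?z k \<in> span (y ` {0..<N})"
        using k by (simp add: z_eq)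
    qed
    then have "span (?z ` {n..<N}) \<subseteq> span (y ` {0..<N})"
      by (rule span_subsetI[OF Y])
    moreover have "span (?z ` {n..<N}) = carrier_vec p"
      using \<open>persistently_exciting p 1 n N ?z\<close> persistently_exciting_1_iff_span[of ?z n N p] Z by simp
    ultimately have "span (y ` {0..<N}) = carrier_vec p"
      using span_closed[OF Y] by auto
    then show "persistently_exciting p 1 0 N (lti_output A B C D x0 u)"
      using persistently_exciting_1_iff_span[of y 0 N p] Y by (simp add: y_def)
  }
  {
    fix Ku
    assume Ku: "pos_def p Ku \<and> K_persistently_exciting Ku p 1 n N ?z"
    \<comment> \<open>\<open>coeff_vec\<close> lists the coefficients in reverse order, which leaves
      the norm unchanged.\<close>
    have d1: "(\<Sum>j\<le>n. (d j)\<^sup>2) = 1"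
    proof -
      have "(\<Sum>j\<le>n. (d j)\<^sup>2) = (\<Sum>i<n + 1. (d (n - i))\<^sup>2)"
        by (rule sum.reindex_bij_witness[of _ "\<lambda>i. n - i" "\<lambda>i. n - i"]) auto
      also have "\<dots> = coeff_vec n d \<bullet> coeff_vec n d"
        by (simp add: coeff_vec_def scalar_prod_def atLeast0LessThan power2_eq_square)
      finally show ?thesis
        using normalized by (simp add: norm2_def)
    qed
    have "v \<bullet> (((1 / (real n + 1)) \<cdot>\<^sub>m Ku) *\<^sub>v v) \<le> (\<Sum>k=0..<N. (y k \<bullet> v)\<^sup>2)"
      if v: "v \<in> carrier_vec p" for v
    proof -
      have Ku_carrier: "Ku \<in> carrier_mat p p"
        using Ku by (simp add: pos_def_def)
      \<comment> \<open>Filtering commutes with taking the product with \<open>v\<close>, which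
        reduces the estimate to scalar signals.\<close>
      have zv: "?z k \<bullet> v = (\<Sum>j\<le>n. d j * (y (k - j) \<bullet> v))" if "n \<le> k" "k < N" for k
      proof -
        have "?z k \<bullet> v = (\<Sum>a=0..<p. \<Sum>j\<le>n. d j * (y (k - j) $ a * v $ a))"
          unfolding z_eq[OF that] using v
          by (simp add: scalar_prod_def sum_distrib_right mult.assoc)
        also have "\<dots> = (\<Sum>j\<le>n. \<Sum>a=0..<p. d j * (y (k - j) $ a * v $ a))"
          by (rule sum.swap)
        finally show ?thesis
          using v by (simp add: scalar_prod_def sum_distrib_left)
      qed
      have "v \<bullet> (Ku *\<^sub>v v) \<le> (\<Sum>k=n..<N. (?z k \<bullet> v)\<^sup>2)"
        using Ku v K_persistently_exciting_1_iff[of ?z n N p Ku] Z by simp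
      also have "\<dots> \<le> (\<Sum>k=n..<N. \<Sum>j\<le>n. (y (k - j) \<bullet> v)\<^sup>2)"
        using zv square_sum_le_sum_squares[OF d1] by (intro sum_mono) simp
      also have "\<dots> \<le> (real n + 1) * (\<Sum>k=0..<N. (y k \<bullet> v)\<^sup>2)"
        by (rule sum_windows_le) simp
      finally have "v \<bullet> (Ku *\<^sub>v v) / (real n + 1) \<le> (\<Sum>k=0..<N. (y k \<bullet> v)\<^sup>2)"
        by (simp add: divide_le_eq mult.commute)
      moreover have "v \<bullet> (((1 / (real n + 1)) \<cdot>\<^sub>m Ku) *\<^sub>v v) = v \<bullet> (Ku *\<^sub>v v) / (real n + 1)"
        using Ku_carrier v quadratic_form_smult by simp
      ultimately show ?thesis
        by simp
    qed
    then show "K_persistently_exciting ((1 / (real n + 1)) \<cdot>\<^sub>m Ku) p 1 0 N (lti_output A B C D x0 u)"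
      using Ku pos_def_smult[of p Ku "1 / (real n + 1)"] K_persistently_exciting_1_iff[of y 0 N p] Y
      by (simp add: y_def)
  }
qed

end
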